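(* Let $k$ and $p$ be fixed integers with $k\geq 2$ and $p\geq 3$. If $G$ is a graph of girth more than $2p$, then $$f_k(G)\leq \Big(1+o(1)\Big)\left(12\binom{k}{2}\right)^{\frac{1}{3}}n(G)^{\frac{p+1}{3p}},$$ where the $o(1)$ term tends to $0$ as $n(G)\to\infty$ for fixed $k$ and $p$ (that is, it is bounded by a function of $n(G)$, depending only on $k$ and $p$, that tends to $0$).
   Context: All graphs are finite, simple, and undirected; $n(G)$ denotes the order of $G$; graphs without cycles have infinite girth. For an integer $k\geq 2$ and a graph $G$, $f_k(G)$ is the minimum cardinality of a set $X$ of vertices of $G$ such that $G-X$ either has at least $k$ vertices whose degree in $G-X$ equals the maximum degree of $G-X$, or has order less than $k$. *)

theory Defs
  imports Complex_Main "HOL-Library.Extended_Nat" "Graph_Theory.Digraph_Component"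
begin

text \<open>
  Finite simple undirected graphs are the locale \<^locale>\<open>Digraph.graph\<close>: finite, symmetric
  digraphs without loops and parallel arcs, each edge \<open>uv\<close> being the pair of arcs from \<open>u\<close> to \<open>v\<close>
  and from \<open>v\<close> to \<open>u\<close>. Hence the degree of a vertex is its \<^const>\<open>out_degree\<close>.
\<close>

text \<open>
  \<^const>\<open>pre_digraph.cycle\<close> also accepts the closed walk \<open>u, v, u\<close> along an edge and back; in the
  absence of loops and parallel arcs, the length bound excludes precisely these. The infimum of the
  empty set of \<^typ>\<open>enat\<close> is \<open>\<infinity>\<close>.
\<close>
definition girth :: "('a, 'b) pre_digraph \<Rightarrow> enat" where
  "girth G = Inf {enat (length c) | c. pre_digraph.cycle G c \<and> 3 \<le> length c}"

definition max_degree :: "('a, 'b) pre_digraph \<Rightarrow> nat" where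
  "max_degree G = Max (out_degree G ` verts G)"

text \<open>
  For \<open>k \<ge> 2\<close> the null graph satisfies the second disjunct, so the unspecified value of
  \<^const>\<open>max_degree\<close> on it is irrelevant.
\<close>
definition repeats_max_degree :: "nat \<Rightarrow> ('a, 'b) pre_digraph \<Rightarrow> bool" where
  "repeats_max_degree k G \<longleftrightarrow>
     k \<le> card {v \<in> verts G. out_degree G v = max_degree G} \<or> card (verts G) < k"

definition f_deg :: "nat \<Rightarrow> ('a, 'b) pre_digraph \<Rightarrow> nat" where
  "f_deg k G = (LEAST m. \<exists>X \<subseteq> verts G. card X = m \<and> repeats_max_degree k (G \<restriction> (verts G - X)))"

end

theory Submission
  imports Defs
begin

text \<open>
  The girth condition excludes 4-cycles, so that two vertices have at most one common neighbour.
  For such graphs on \<open>n\<close> vertices the stronger bound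
  \<open>f\<^sub>k(G) \<le> 3 k n\<^bsup>1/3\<^esup> + O(k\<^sup>2)\<close> holds, and \<open>n\<^bsup>1/3\<^esup> = o(n\<^bsup>(p+1)/(3p)\<^esup>)\<close> for fixed \<open>p\<close>.

  Let \<open>S\<close> consist of \<open>k\<close> vertices of largest degree in an induced subgraph of maximum degree \<open>M\<close>,
  and let \<open>D\<close> be the smallest of their degrees. If \<open>D \<ge> 2k\<close>, each member of \<open>S\<close> has so many
  neighbours that are not shared with the rest of \<open>S\<close> that it can be brought down to degree exactly
  \<open>D\<close> by deleting such private neighbours; this makes \<open>S\<close> a set of \<open>k\<close> vertices of maximum degree
  at a price of at most \<open>k (M - D)\<close> vertices (lemma \<open>equalize_top_set\<close>). If \<open>D < 2k\<close>, a repetition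
  costs at most \<open>2k\<^sup>2 + k\<close> further vertices (lemma \<open>repetition_of_small_degree\<close>).

  Suppose now that \<open>3kq + 2k\<^sup>2\<close> deletions never suffice. Then deleting \<open>S\<close>, after which no degree exceeds \<open>D\<close>, must lower the maximum
  degree by at least \<open>q\<close>, as long as at most about \<open>2kq\<close> vertices have been deleted. Peeling off
  such sets \<open>q\<close> times shows that a vertex of degree at least \<open>q\<^sup>2\<close> survives the deletion of any
  \<open>kq\<close> vertices (lemma \<open>large_degree_survives\<close>), so at least \<open>q\<close> vertices have degree at
  least \<open>q\<^sup>2\<close>. Their neighbourhoods are almost disjoint, whence \<open>q\<^sup>3 \<le> n + q\<^sup>2\<close>
  (lemma \<open>few_large_degrees\<close>). This fails once \<open>q\<close> exceeds \<open>n\<^bsup>1/3\<^esup> + 1\<close>.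
\<close>

section \<open>Maximum degrees in graphs without 4-cycles\<close>

lemma top_set_exists:
  fixes f :: "'v \<Rightarrow> nat"
  assumes "finite W" "k \<le> card W"
  shows "\<exists>S\<subseteq>W. card S = k \<and> (\<forall>s\<in>S. \<forall>u\<in>W - S. f u \<le> f s)"
  using assms(2)
proof (induction k)
  case 0
  show ?case by (intro exI[of _ "{}"]) auto
next
  case (Suc k)
  then obtain S where S: "S \<subseteq> W" "card S = k" "\<forall>s\<in>S. \<forall>u\<in>W - S. f u \<le> f s"
    by auto
  have "finite S" using S(1) assms(1) finite_subset by blast
  have "W - S \<noteq> {}"
    using S(1,2) Suc.prems by (metis Diff_eq_empty_iff Suc_n_not_le_n subset_antisym)
  then have "Max (f ` (W - S)) \<in> f ` (W - S)"
    using assms(1) by (intro Max_in) auto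
  then obtain x where x: "x \<in> W - S" "Max (f ` (W - S)) = f x" by blast
  have x_max: "f u \<le> f x" if "u \<in> W - S" for u
    unfolding x(2)[symmetric] using that assms(1) by (intro Max_ge) auto
  show ?case
    using S x(1) x_max \<open>finite S\<close> by (intro exI[of _ "insert x S"]) auto
qed

text \<open>
  With an adjacency relation in place of arcs, the degree of \<open>v\<close> in the subgraph induced by \<open>W\<close> is
  the size of a subset of \<open>W\<close>, and can be compared with subsets of \<open>V\<close> by counting vertices.
\<close>
locale quadrangle_free =
  fixes V :: "'v set" and adj :: "'v \<Rightarrow> 'v \<Rightarrow> bool"
  assumes finite_V: "finite V"
    and common_nbs: "\<lbrakk>v \<in> V; w \<in> V; v \<noteq> w\<rbrakk> \<Longrightarrow> card {u\<in>V. adj v u \<and> adj w u} \<le> 1"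
begin

definition nbs :: "'v set \<Rightarrow> 'v \<Rightarrow> 'v set" where
  "nbs W v = {u\<in>W. adj v u}"

definition deg :: "'v set \<Rightarrow> 'v \<Rightarrow> nat" where
  "deg W v = card (nbs W v)"

text \<open>
  For \<open>k > 0\<close> the number \<open>D\<close> is the maximum degree; quantifying over it avoids the maximum of a
  possibly empty set.
\<close>
definition repetition :: "nat \<Rightarrow> 'v set \<Rightarrow> bool" where
  "repetition k W \<longleftrightarrow>
     card W < k \<or> (\<exists>D. (\<forall>v\<in>W. deg W v \<le> D) \<and> k \<le> card {v\<in>W. deg W v = D})"

lemma finite_sub: "W \<subseteq> V \<Longrightarrow> finite W"
  using finite_V finite_subset by blast

lemma finite_nbs [simp]: "W \<subseteq> V \<Longrightarrow> finite (nbs W v)"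
  unfolding nbs_def using finite_sub by auto

lemma deg_mono: "\<lbrakk>A \<subseteq> B; B \<subseteq> V\<rbrakk> \<Longrightarrow> deg A v \<le> deg B v"
  unfolding deg_def by (rule card_mono) (auto simp: nbs_def intro: finite_subset[OF _ finite_V])

lemma card_common_nbs:
  assumes "W \<subseteq> V" "v \<in> V" "w \<in> V" "v \<noteq> w"
  shows "card (nbs W v \<inter> nbs W w) \<le> 1"
proof -
  have "card (nbs W v \<inter> nbs W w) \<le> card {u\<in>V. adj v u \<and> adj w u}"
    using assms(1) finite_V by (intro card_mono) (auto simp: nbs_def)
  then show ?thesis using common_nbs[OF assms(2-4)] by linarith
qed

text \<open>
  While fewer than \<open>k\<close> vertices attain the maximum degree, deleting all of them lowers it; an
  edgeless graph has a repetition unless it is too small.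
\<close>
lemma repetition_of_small_degree:
  assumes "W \<subseteq> V" "\<forall>v\<in>W. deg W v \<le> D"
  shows "\<exists>R\<subseteq>W. card R \<le> k * D \<and> repetition k (W - R)"
  using assms
proof (induction D arbitrary: W)
  case 0
  then have "{v\<in>W. deg W v = 0} = W" by auto
  then have "repetition k W"
    using "0.prems"(2) by (cases "card W < k") (auto simp: repetition_def intro!: exI[of _ 0])
  then show ?case by (intro exI[of _ "{}"]) auto
next
  case (Suc D)
  define T where "T = {v\<in>W. deg W v = Suc D}"
  show ?case
  proof (cases "k \<le> card T")
    case True
    then have "repetition k W"
      using Suc.prems(2) by (auto simp: repetition_def T_def)
    then show ?thesis by (intro exI[of _ "{}"]) auto
  next
    case False
    have "deg (W - T) v \<le> D" if "v \<in> W - T" for v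
    proof -
      have "deg W v \<le> D" using that Suc.prems(2) by (force simp: T_def)
      then show ?thesis using deg_mono[of "W - T" W v] Suc.prems(1) by auto
    qed
    then obtain R where R: "R \<subseteq> W - T" "card R \<le> k * D" "repetition k (W - T - R)"
      using Suc.IH[of "W - T"] Suc.prems(1) by auto
    have "card (T \<union> R) \<le> k * Suc D"
      using card_Un_le[of T R] R(2) False by simp
    moreover have "W - (T \<union> R) = W - T - R" by auto
    ultimately show ?thesis
      using R by (intro exI[of _ "T \<union> R"]) (auto simp: T_def)
  qed
qed

definition private_nbs :: "'v set \<Rightarrow> 'v set \<Rightarrow> 'v \<Rightarrow> 'v set" where
  "private_nbs W S v = {u \<in> nbs W v - S. \<forall>w\<in>S - {v}. \<not> adj w u}"

text \<open>
  A neighbour fails to be private only by lying in \<open>S\<close> or by being the one common neighbour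
  with another member of \<open>S\<close>.
\<close>
lemma deg_le_private_nbs:
  assumes "W \<subseteq> V" "S \<subseteq> W" "v \<in> S"
  shows "deg W v \<le> card (private_nbs W S v) + 2 * card S"
proof -
  have fS: "finite S" using assms finite_sub by blast
  let ?C = "\<Union>w\<in>S - {v}. nbs W v \<inter> nbs W w"
  have sub: "nbs W v \<subseteq> private_nbs W S v \<union> (S \<union> ?C)"
    by (auto simp: private_nbs_def nbs_def)
  have "card ?C \<le> (\<Sum>w\<in>S - {v}. card (nbs W v \<inter> nbs W w))"
    using fS by (intro card_UN_le) auto
  also have "\<dots> \<le> (\<Sum>w\<in>S - {v}. 1)"
    using assms by (intro sum_mono card_common_nbs) auto
  also have "\<dots> \<le> card S" using fS by (simp add: card_Diff1_le)
  finally have C: "card ?C \<le> card S" .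
  have "finite (private_nbs W S v \<union> (S \<union> ?C))"
    using fS assms(1) by (auto simp: private_nbs_def)
  then have "card (nbs W v) \<le> card (private_nbs W S v \<union> (S \<union> ?C))"
    using sub by (intro card_mono)
  also have "\<dots> \<le> card (private_nbs W S v) + (card S + card ?C)"
    by (meson add_left_mono card_Un_le order_trans)
  finally show ?thesis unfolding deg_def using C by linarith
qed

text \<open>
  Deleting a private neighbour of one member of \<open>S\<close> affects no other member, so the degrees
  can be adjusted independently of each other.
\<close>
lemma equalize_top_set:
  assumes "W \<subseteq> V" "S \<subseteq> W" "card S = k" "2 * k \<le> D"
    and S: "\<forall>v\<in>S. D \<le> deg W v \<and> deg W v \<le> M"
    and rest: "\<forall>u\<in>W - S. deg W u \<le> D"
  shows "\<exists>R\<subseteq>W. card R \<le> k * (M - D) \<and> repetition k (W - R)"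
proof -
  have fS: "finite S" using assms(1,2) finite_sub by blast
  have "\<exists>Q\<subseteq>private_nbs W S v. card Q = deg W v - D" if "v \<in> S" for v
  proof -
    have "deg W v - D \<le> card (private_nbs W S v)"
      using deg_le_private_nbs[OF assms(1,2) that] assms(3,4) by linarith
    then show ?thesis by (meson obtain_subset_with_card_n)
  qed
  then obtain Q where Q: "\<And>v. v \<in> S \<Longrightarrow> Q v \<subseteq> private_nbs W S v"
    and card_Q: "\<And>v. v \<in> S \<Longrightarrow> card (Q v) = deg W v - D"
    by metis
  define R where "R = (\<Union>v\<in>S. Q v)"
  have RW: "R \<subseteq> W" and RS: "R \<inter> S = {}"
    using Q by (fastforce simp: R_def private_nbs_def nbs_def)+
  have "card R \<le> (\<Sum>v\<in>S. card (Q v))"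
    unfolding R_def using fS by (intro card_UN_le)
  also have "\<dots> \<le> (\<Sum>v\<in>S. M - D)"
    using S by (intro sum_mono) (auto simp: card_Q)
  finally have card_R: "card R \<le> k * (M - D)" using assms(3) by simp
  have deg_S: "deg (W - R) v = D" if v: "v \<in> S" for v
  proof -
    have "nbs (W - R) v = nbs W v - Q v"
      using Q v by (fastforce simp: R_def private_nbs_def nbs_def)
    moreover have "Q v \<subseteq> nbs W v" using Q[OF v] by (auto simp: private_nbs_def)
    moreover have "finite (Q v)"
      using \<open>Q v \<subseteq> nbs W v\<close> assms(1) finite_nbs finite_subset by blast
    ultimately have "deg (W - R) v = deg W v - (deg W v - D)"
      by (simp add: deg_def card_Diff_subset card_Q[OF v, unfolded deg_def])
    then show ?thesis using S v by simp
  qed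
  have "deg (W - R) u \<le> D" if "u \<in> W - R" for u
    using that deg_S rest deg_mono[of "W - R" W u] assms(1)
    by (cases "u \<in> S") (auto intro: order_trans)
  moreover have "k \<le> card {v\<in>W - R. deg (W - R) v = D}"
  proof -
    have "S \<subseteq> {v\<in>W - R. deg (W - R) v = D}" using deg_S RS assms(2) by auto
    moreover have "finite {v\<in>W - R. deg (W - R) v = D}" using finite_sub[OF assms(1)] by simp
    ultimately show ?thesis unfolding assms(3)[symmetric] by (rule card_mono[rotated])
  qed
  ultimately have "repetition k (W - R)" by (auto simp: repetition_def)
  then show ?thesis using RW card_R by blast
qed

text \<open>
  Induction on \<open>j\<close>: after deleting the top set \<open>S\<close> a vertex of degree at least \<open>j q\<close> is left, so every
  member of \<open>S\<close> has at least this degree, and some member exceeds the smallest degree in \<open>S\<close> by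
  \<open>q\<close>, as otherwise it would be cheap to equalize the degrees in \<open>S\<close>. Of the allowance \<open>L\<close>, the
  amount \<open>k j\<close> pays for the sets peeled off, and \<open>k q + 2k\<^sup>2\<close> for the final repetition.
\<close>
lemma large_degree_survives:
  assumes never: "\<And>X. \<lbrakk>X \<subseteq> V; repetition k (V - X)\<rbrakk> \<Longrightarrow> L < card X"
    and "0 < k"
  shows "\<lbrakk>W \<subseteq> V; card (V - W) + k * j + k * q + 2 * k\<^sup>2 \<le> L\<rbrakk> \<Longrightarrow> \<exists>v\<in>W. j * q \<le> deg W v"
proof (induction j arbitrary: W)
  case 0
  have "V - (V - W) = W" using "0.prems"(1) by auto
  then have "\<not> repetition k W"
    using never[of "V - W"] "0.prems"(2) by auto
  then have "W \<noteq> {}" using \<open>0 < k\<close> by (auto simp: repetition_def)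
  then show ?case by auto
next
  case (Suc j)
  note WV = Suc.prems(1)
  have never_W: "\<not> repetition k (W - R)" if "R \<subseteq> W" "card (V - W) + card R \<le> L" for R
  proof
    assume "repetition k (W - R)"
    moreover have "V - ((V - W) \<union> R) = W - R" using WV by auto
    ultimately have "L < card ((V - W) \<union> R)"
      using never[of "(V - W) \<union> R"] that(1) WV by auto
    then show False using that(2) card_Un_le[of "V - W" R] by linarith
  qed
  have fW: "finite W" using WV by (rule finite_sub)
  have "k \<le> card W"
    using never_W[of "{}"] Suc.prems(2) by (auto simp: repetition_def)
  then obtain S where S: "S \<subseteq> W" "card S = k" "\<forall>s\<in>S. \<forall>u\<in>W - S. deg W u \<le> deg W s"
    using top_set_exists[OF fW] by metis
  have fS: "finite S" and "S \<noteq> {}" using S fW finite_subset \<open>0 < k\<close> by auto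
  define D where "D = Min (deg W ` S)"
  define M where "M = Max (deg W ` W)"
  have D_le: "D \<le> deg W v" if "v \<in> S" for v using that fS by (simp add: D_def)
  have le_M: "deg W v \<le> M" if "v \<in> W" for v using that fW by (simp add: M_def)
  have rest: "deg W u \<le> D" if "u \<in> W - S" for u
    using that S(3) fS \<open>S \<noteq> {}\<close> by (simp add: D_def)
  have "V - (W - S) = (V - W) \<union> S" using S(1) WV by auto
  then have "card (V - (W - S)) \<le> card (V - W) + k"
    using card_Un_le[of "V - W" S] S(2) by simp
  then obtain x where x: "x \<in> W - S" "j * q \<le> deg (W - S) x"
    using Suc.IH[of "W - S"] Suc.prems by force
  then have jq: "j * q \<le> D"
    using rest[OF x(1)] deg_mono[of "W - S" W x] WV by auto
  have "2 * k \<le> D"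
  proof (rule ccontr)
    assume "\<not> 2 * k \<le> D"
    moreover have "deg (W - S) u \<le> deg W u" for u
      using WV by (intro deg_mono) auto
    ultimately have "\<forall>u\<in>W - S. deg (W - S) u \<le> 2 * k"
      using rest by (meson nat_le_linear order_trans)
    then obtain R where R: "R \<subseteq> W - S" "card R \<le> k * (2 * k)" "repetition k (W - S - R)"
      using repetition_of_small_degree[of "W - S" "2 * k" k] WV by auto
    have "card (S \<union> R) \<le> k + 2 * k\<^sup>2"
      using card_Un_le[of S R] S(2) R(2) by (simp add: power2_eq_square)
    then have "card (V - W) + card (S \<union> R) \<le> L" using Suc.prems(2) by simp
    moreover have "W - (S \<union> R) = W - S - R" by auto
    ultimately show False using never_W[of "S \<union> R"] R S(1) by auto
  qed
  then obtain R where R: "R \<subseteq> W" "card R \<le> k * (M - D)" "repetition k (W - R)"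
    using equalize_top_set[OF WV S(1,2), of D M] D_le le_M rest S(1) by blast
  have "q \<le> M - D"
  proof (rule ccontr)
    assume "\<not> q \<le> M - D"
    then have "card R \<le> k * q" using R(2) by (meson le_trans mult_le_mono2 nat_le_linear)
    then show False using never_W[of R] R Suc.prems(2) by simp
  qed
  \<comment> \<open>Subtraction is truncated, so for \<open>q = 0\<close> the bound \<open>q \<le> M - D\<close> does not give \<open>D + q \<le> M\<close>.\<close>
  moreover have "D \<le> M" using D_le le_M S(1) \<open>S \<noteq> {}\<close> by (meson all_not_in_conv order_trans subsetD)
  ultimately have "Suc j * q \<le> M" using jq by simp
  moreover have "M \<in> deg W ` W"
    unfolding M_def using fW S(1) \<open>S \<noteq> {}\<close> by (intro Max_in) auto
  ultimately show ?case by auto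
qed

text \<open>
  Adding a vertex to \<open>H\<close> loses at most one element per earlier member to overlaps of the
  neighbourhoods, hence at most \<open>(card H)\<^sup>2\<close> altogether.
\<close>
lemma few_large_degrees:
  assumes "H \<subseteq> V" "\<forall>v\<in>H. d \<le> deg V v"
  shows "card H * d \<le> card V + (card H)\<^sup>2"
proof -
  have "finite H" using assms(1) by (rule finite_sub)
  then have "card H * d \<le> card (\<Union>v\<in>H. nbs V v) + (card H)\<^sup>2"
    using assms
  proof (induction H)
    case empty
    then show ?case by simp
  next
    case (insert x H)
    let ?U = "\<Union>v\<in>H. nbs V v"
    have fU: "finite ?U" using insert.hyps(1) by simp
    have "card (nbs V x \<inter> ?U) \<le> (\<Sum>v\<in>H. card (nbs V x \<inter> nbs V v))"
      using card_UN_le[OF insert.hyps(1), of "\<lambda>v. nbs V x \<inter> nbs V v"] by simp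
    also have "\<dots> \<le> (\<Sum>v\<in>H. 1)"
      using insert.prems(1) insert.hyps(2) by (intro sum_mono card_common_nbs) auto
    finally have "card (nbs V x \<inter> ?U) \<le> card H" by simp
    moreover have "card (nbs V x) + card ?U = card (nbs V x \<union> ?U) + card (nbs V x \<inter> ?U)"
      using fU by (intro card_Un_Int) auto
    moreover have "d \<le> card (nbs V x)" using insert.prems(2) by (simp add: deg_def)
    moreover have "card H * d \<le> card ?U + (card H)\<^sup>2" using insert by auto
    ultimately show ?case
      using insert.hyps by (simp add: power2_eq_square)
  qed
  moreover have "card (\<Union>v\<in>H. nbs V v) \<le> card V"
    using finite_V by (intro card_mono) (auto simp: nbs_def)
  ultimately show ?thesis by linarith
qed

text \<open>
  If the deletions never sufficed, the set \<open>H\<close> of vertices of degree at least \<open>q\<^sup>2\<close> would have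
  \<open>q\<close> elements: deleting a smaller \<open>H\<close> would leave another such vertex.
\<close>
lemma repetition_by_few_deletions:
  assumes "0 < k" "card V + q\<^sup>2 < q ^ 3"
  shows "\<exists>X\<subseteq>V. card X \<le> 3 * k * q + 2 * k\<^sup>2 \<and> repetition k (V - X)"
proof (rule ccontr)
  assume "\<not> ?thesis"
  then have never: "\<And>X. \<lbrakk>X \<subseteq> V; repetition k (V - X)\<rbrakk> \<Longrightarrow> 3 * k * q + 2 * k\<^sup>2 < card X"
    by (meson not_le)
  define H where "H = {v\<in>V. q * q \<le> deg V v}"
  have "q \<le> card H"
  proof (rule ccontr)
    assume "\<not> q \<le> card H"
    moreover have "V - (V - H) = H" by (auto simp: H_def)
    moreover have "q \<le> k * q" using assms(1) by simp
    ultimately have "card (V - (V - H)) \<le> k * q" by (metis nat_le_linear order_trans)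
    then obtain v where "v \<in> V - H" "q * q \<le> deg (V - H) v"
      using large_degree_survives[OF never assms(1), of "V - H" q q] by auto
    then show False using deg_mono[of "V - H" V v] by (auto simp: H_def)
  qed
  then obtain H' where H': "H' \<subseteq> H" "card H' = q" by (meson obtain_subset_with_card_n)
  then have "q * (q * q) \<le> card V + q\<^sup>2"
    using few_large_degrees[of H' "q * q"] by (auto simp: H_def)
  then show False using assms(2) by (simp add: power3_eq_cube)
qed

end

section \<open>Graphs of girth more than 4\<close>

text \<open>Vertices \<open>v\<close> and \<open>w\<close> with common neighbours \<open>x\<close> and \<open>y\<close> give the cycle \<open>v x w y\<close>.\<close>
lemma common_neighbours_le_1:
  assumes "graph G" and girth: "4 < girth G" and "v \<noteq> w"
  shows "card {u\<in>verts G. v \<rightarrow>\<^bsub>G\<^esub> u \<and> w \<rightarrow>\<^bsub>G\<^esub> u} \<le> 1"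
proof (rule ccontr)
  interpret graph G by fact
  assume "\<not> ?thesis"
  then obtain x y where xy: "x \<noteq> y" "v \<rightarrow>\<^bsub>G\<^esub> x" "w \<rightarrow>\<^bsub>G\<^esub> x" "v \<rightarrow>\<^bsub>G\<^esub> y" "w \<rightarrow>\<^bsub>G\<^esub> y"
    by (auto simp: card_le_Suc0_iff_eq)
  then have "x \<rightarrow>\<^bsub>G\<^esub> w" "y \<rightarrow>\<^bsub>G\<^esub> v" using arcs_ends_symmetric[OF sym_arcs] by blast+
  with xy obtain a b c d where arcs: "a \<in> arcs G" "b \<in> arcs G" "c \<in> arcs G" "d \<in> arcs G"
    and ends: "tail G a = v" "head G a = x" "tail G b = x" "head G b = w"
      "tail G c = w" "head G c = y" "tail G d = y" "head G d = v"
    by (auto simp: arcs_ends_def arc_to_ends_def)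
  have "v \<noteq> x" "v \<noteq> y" "w \<noteq> x" "w \<noteq> y" using xy adj_not_same by blast+
  then have "cycle [a, b, c, d]"
    using arcs ends xy(1) \<open>v \<noteq> w\<close>
    by (auto simp: cycle_def awalk_Cons_iff awalk_Nil_iff intro!: exI[of _ v])
  then have "girth G \<le> enat (length [a, b, c, d])"
    unfolding girth_def by (intro Inf_lower) (auto intro!: exI[of _ "[a, b, c, d]"])
  moreover have "length [a, b, c, d] = 4" by simp
  ultimately show False using girth by (metis numeral_eq_enat not_le)
qed

lemma out_degree_induce_subgraph:
  assumes "graph G" "v \<in> W" "W \<subseteq> verts G"
  shows "out_degree (G \<restriction> W) v = card {u\<in>W. v \<rightarrow>\<^bsub>G\<^esub> u}"
proof -
  interpret graph G by fact
  have "bij_betw (head G) (out_arcs (G \<restriction> W) v) {u\<in>W. v \<rightarrow>\<^bsub>G\<^esub> u}"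
    unfolding bij_betw_def
  proof
    show "inj_on (head G) (out_arcs (G \<restriction> W) v)"
      by (rule inj_onI) (auto intro!: no_multi_arcs simp: arc_to_ends_def out_arcs_def induce_subgraph_def)
    show "head G ` out_arcs (G \<restriction> W) v = {u\<in>W. v \<rightarrow>\<^bsub>G\<^esub> u}"
      using assms(2)
      by (auto simp: out_arcs_def induce_subgraph_def arcs_ends_def arc_to_ends_def image_iff)
  qed
  then show ?thesis unfolding out_degree_def by (rule bij_betw_same_card)
qed

lemma f_deg_le:
  assumes "graph G" "4 < girth G" "0 < k" "card (verts G) + q\<^sup>2 < q ^ 3"
  shows "f_deg k G \<le> 3 * k * q + 2 * k\<^sup>2"
proof -
  interpret graph G by fact
  interpret quadrangle_free "verts G" "\<lambda>v u. v \<rightarrow>\<^bsub>G\<^esub> u"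
    by unfold_locales (use common_neighbours_le_1[OF assms(1,2)] in auto)
  obtain X where X: "X \<subseteq> verts G" "card X \<le> 3 * k * q + 2 * k\<^sup>2" "repetition k (verts G - X)"
    using repetition_by_few_deletions[OF assms(3,4)] by blast
  let ?W = "verts G - X"
  have deg: "out_degree (G \<restriction> ?W) v = deg ?W v" if "v \<in> ?W" for v
    using out_degree_induce_subgraph[OF assms(1) that] by (simp add: deg_def nbs_def)
  have "repeats_max_degree k (G \<restriction> ?W)"
  proof (cases "card ?W < k")
    case True
    then show ?thesis by (simp add: repeats_max_degree_def)
  next
    case False
    then obtain D where D: "\<forall>v\<in>?W. deg ?W v \<le> D" "k \<le> card {v\<in>?W. deg ?W v = D}"
      using X(3) by (auto simp: repetition_def)
    then have "{v\<in>?W. deg ?W v = D} \<noteq> {}" using assms(3) by (metis card.empty not_le)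
    then obtain v where "v \<in> ?W" "deg ?W v = D" by blast
    then have "max_degree (G \<restriction> ?W) = D"
      unfolding max_degree_def using D(1) deg
      by (intro Max_eqI) (auto simp: image_iff intro!: bexI[of _ v])
    moreover have "{v\<in>?W. out_degree (G \<restriction> ?W) v = D} = {v\<in>?W. deg ?W v = D}"
      using deg by auto
    ultimately show ?thesis using D(2) by (simp add: repeats_max_degree_def)
  qed
  then have "f_deg k G \<le> card X"
    unfolding f_deg_def using X(1) by (intro Least_le) blast
  then show ?thesis using X(2) by linarith
qed

lemma f_deg_le_root:
  assumes "graph G" "4 < girth G" "0 < k"
  shows "real (f_deg k G) \<le> 3 * k * root 3 (card (verts G)) + 6 * k + 2 * k\<^sup>2"
proof -
  define r where "r = root 3 (card (verts G))"
  have r0: "0 \<le> r" and r3: "r ^ 3 = card (verts G)" by (simp_all add: r_def)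
  \<comment> \<open>Large enough for \<open>r < q - 1\<close>, which gives \<open>n < (q - 1)\<^sup>3 \<le> q\<^sup>2 (q - 1) = q\<^sup>3 - q\<^sup>2\<close> for the order \<open>n\<close>.\<close>
  define q where "q = nat \<lfloor>r\<rfloor> + 2"
  have q: "real q \<le> r + 2" "r + 1 < real q" using r0 by (simp_all add: q_def) linarith
  have "real (card (verts G)) < (real q - 1) ^ 3"
    unfolding r3[symmetric] using q(2) r0 by (intro power_strict_mono) auto
  also have "\<dots> \<le> real q ^ 2 * (real q - 1)"
  proof -
    have "(real q - 1) ^ 2 \<le> real q ^ 2" using q(2) r0 by (intro power_mono) auto
    then have "(real q - 1) ^ 2 * (real q - 1) \<le> real q ^ 2 * (real q - 1)"
      using q(2) r0 by (intro mult_right_mono) auto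
    then show ?thesis by (simp add: power3_eq_cube power2_eq_square)
  qed
  finally have "real (card (verts G) + q\<^sup>2) < real (q ^ 3)"
    by (simp add: algebra_simps power3_eq_cube power2_eq_square)
  then have "f_deg k G \<le> 3 * k * q + 2 * k\<^sup>2"
    using f_deg_le[OF assms] by (simp only: of_nat_less_iff)
  then have "real (f_deg k G) \<le> real (3 * k * q + 2 * k\<^sup>2)" by (simp only: of_nat_le_iff)
  also have "\<dots> = 3 * k * real q + 2 * k\<^sup>2" by simp
  also have "\<dots> \<le> 3 * k * (r + 2) + 2 * k\<^sup>2"
    using q(1) by (intro add_right_mono mult_left_mono) auto
  finally show ?thesis by (simp add: r_def algebra_simps)
qed

lemma f_deg_empty:
  assumes "card (verts G) = 0" "0 < k"
  shows "f_deg k G = 0"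
  unfolding f_deg_def
  by (rule Least_eq_0) (use assms in \<open>auto simp: repeats_max_degree_def intro!: exI[of _ "{}"]\<close>)

theorem corollary2p10:
  fixes k p :: nat
  assumes "2 \<le> k" and "3 \<le> p"
  shows "\<exists>\<epsilon> :: nat \<Rightarrow> real. \<epsilon> \<longlonglongrightarrow> 0 \<and>
    (\<forall>G :: ('a, 'b) pre_digraph. Digraph.graph G \<longrightarrow> enat (2 * p) < girth G \<longrightarrow>
      real (f_deg k G) \<le> (1 + \<epsilon> (card (verts G))) * (12 * real (k choose 2)) powr (1 / 3)
        * real (card (verts G)) powr ((real p + 1) / (3 * real p)))"
proof -
  \<comment> \<open>For order \<open>n \<ge> 1\<close> the bound of \<open>f_deg_le_root\<close> is at most \<open>c n\<^bsup>1/3\<^esup>\<close>, and dividing this by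
    \<open>n\<^bsup>(p+1)/(3p)\<^esup>\<close> leaves \<open>c n\<^bsup>-1/(3p)\<^esup>\<close>.\<close>
  define c where "c = 9 * real k + 2 * real k ^ 2"
  define \<epsilon> where "\<epsilon> n = c * real n powr (- (1 / (3 * real p)))" for n :: nat
  have c0: "0 \<le> c" by (simp add: c_def)
  have "(\<lambda>n. real n powr (- (1 / (3 * real p)))) \<longlonglongrightarrow> 0"
    using assms(2) by (intro tendsto_neg_powr filterlim_real_sequentially) auto
  then have lim: "\<epsilon> \<longlonglongrightarrow> 0"
    unfolding \<epsilon>_def by (rule tendsto_mult_right_zero)
  have bound: "real (f_deg k G) \<le> (1 + \<epsilon> (card (verts G))) * (12 * real (k choose 2)) powr (1 / 3)
      * real (card (verts G)) powr ((real p + 1) / (3 * real p))"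
    if G: "graph G" "enat (2 * p) < girth G" for G :: "('a, 'b) pre_digraph"
  proof (cases "card (verts G) = 0")
    case True
    then show ?thesis using f_deg_empty[OF True] assms(1) by simp
  next
    case False
    define n where "n = real (card (verts G))"
    have n1: "1 \<le> n" using False by (simp add: n_def)
    define K where "K = (12 * real (k choose 2)) powr (1 / 3)"
    define e where "e = (real p + 1) / (3 * real p)"
    have "1 \<le> k choose 2" using assms(1) by (simp add: Suc_leI zero_less_binomial_iff)
    then have K1: "1 \<le> K" unfolding K_def by (intro ge_one_powr_ge_zero) auto
    have "(4 :: enat) \<le> enat (2 * p)" using assms(2) by (simp add: numeral_eq_enat)
    then have "4 < girth G" using G(2) by (rule order.strict_trans1)
    then have "real (f_deg k G) \<le> 3 * k * root 3 n + 6 * k + 2 * k\<^sup>2"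
      using f_deg_le_root[OF G(1)] assms(1) by (simp add: n_def)
    also have "\<dots> \<le> c * root 3 n"
    proof -
      have "(6 * real k + 2 * real k ^ 2) * 1 \<le> (6 * real k + 2 * real k ^ 2) * root 3 n"
        using n1 by (intro mult_left_mono) auto
      then show ?thesis by (simp add: c_def algebra_simps)
    qed
    also have "\<dots> = c * n powr (1 / 3)" using n1 by (simp add: root_powr_inverse)
    also have "\<dots> = c * (n powr (- (1 / (3 * real p))) * n powr e)"
    proof -
      have "1 / 3 = - (1 / (3 * real p)) + e" using assms(2) by (simp add: e_def field_simps)
      then show ?thesis by (metis powr_add)
    qed
    also have "\<dots> = \<epsilon> (card (verts G)) * n powr e" by (simp add: \<epsilon>_def n_def)
    also have "\<dots> \<le> (1 + \<epsilon> (card (verts G))) * K * n powr e"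
    proof (rule mult_right_mono)
      have "0 \<le> \<epsilon> (card (verts G))" using c0 by (simp add: \<epsilon>_def)
      then have "(1 + \<epsilon> (card (verts G))) * 1 \<le> (1 + \<epsilon> (card (verts G))) * K"
        using K1 by (intro mult_left_mono) auto
      then show "\<epsilon> (card (verts G)) \<le> (1 + \<epsilon> (card (verts G))) * K" by simp
    qed simp
    finally show ?thesis by (simp add: K_def e_def n_def)
  qed
  show ?thesis using lim bound by blast
qed

end
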